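(* Let $q_0\in\mathbb{R}$, let $r>0$, let $B=B(q_0,r)=\{q\in\mathbb{H} : |q-q_0|<r\}$, and let $f$ be a quaternion-valued function that is slice regular on the closed ball $\overline{B(q_0,r)}$ (that is, slice regular on a domain of $\mathbb{H}$ containing $\overline{B(q_0,r)}$). Set $$A=\max_{|q-q_0|=r}|\operatorname{Re} f(q)|,$$ and write $f(q_0)=\beta+\gamma I$ with $\beta,\gamma\in\mathbb{R}$ and $I\in\mathbb{S}$. If $\varrho\in\mathbb{R}$ is such that $0<\varrho<r$, then $$|f(q)|\leq |\gamma|+|\beta|\,\frac{r+\varrho}{r-\varrho}+2A\,\frac{\varrho}{r-\varrho}$$ for all $q\in B$ such that $|q-q_0|\leq\varrho$.
   Context: $\mathbb{H}$ denotes the skew field of quaternions $q=x_0+x_1i+x_2j+x_3k$ ($x_l\in\mathbb{R}$), with real part $\operatorname{Re}(q)=x_0$ and modulus $|q|=\sqrt{x_0^2+x_1^2+x_2^2+x_3^2}$. $\mathbb{S}=\{q\in\mathbb{H} : q^2=-1\}$ is the 2-sphere of imaginary units; every quaternion can be written as $x+yI$ with $x,y\in\mathbb{R}$, $I\in\mathbb{S}$. For $I\in\mathbb{S}$, $L_I=\mathbb{R}+I\mathbb{R}$, and for $\Omega\subset\mathbb{H}$, $\Omega_I=\Omega\cap L_I$. Slice regularity: let $\Omega$ be a domain in $\mathbb{H}$. A function $f:\Omega\to\mathbb{H}$ is slice regular if, for every $I\in\mathbb{S}$, its restriction $f_I$ to $\Omega_I$ has continuous partial derivatives and satisfies $$\frac12\Big(\frac{\partial}{\partial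 x}+I\frac{\partial}{\partial y}\Big)f_I(x+yI)=0$$ for every $x+yI\in\Omega_I$. *)

theory Defs
  imports "HOL-Analysis.Analysis"
begin

section \<open>The normed division algebra of quaternions\<close>

text \<open>The quaternion \<open>Quat a b c d\<close> is \<open>a + b i + c j + d k\<close>.\<close>

codatatype quat = Quat (qre: real) (qi: real) (qj: real) (qk: real)

lemma quat_eq_iff:
  "p = q \<longleftrightarrow> qre p = qre q \<and> qi p = qi q \<and> qj p = qj q \<and> qk p = qk q"
  using quat.expand by auto

instantiation quat :: ab_group_add
begin

primcorec zero_quat where
  "qre 0 = 0" | "qi 0 = 0" | "qj 0 = 0" | "qk 0 = 0"

primcorec plus_quat where
  "qre (p + q) = qre p + qre q"
| "qi (p + q) = qi p + qi q"
| "qj (p + q) = qj p + qj q"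
| "qk (p + q) = qk p + qk q"

primcorec uminus_quat where
  "qre (- q) = - qre q"
| "qi (- q) = - qi q"
| "qj (- q) = - qj q"
| "qk (- q) = - qk q"

primcorec minus_quat where
  "qre (p - q) = qre p - qre q"
| "qi (p - q) = qi p - qi q"
| "qj (p - q) = qj p - qj q"
| "qk (p - q) = qk p - qk q"

instance
  by standard (simp_all add: quat_eq_iff)

end

instantiation quat :: ring_1
begin

primcorec one_quat where
  "qre 1 = 1" | "qi 1 = 0" | "qj 1 = 0" | "qk 1 = 0"

primcorec times_quat where
  "qre (p * q) = qre p * qre q - qi p * qi q - qj p * qj q - qk p * qk q"
| "qi (p * q) = qre p * qi q + qi p * qre q + qj p * qk q - qk p * qj q"
| "qj (p * q) = qre p * qj q - qi p * qk q + qj p * qre q + qk p * qi q"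
| "qk (p * q) = qre p * qk q + qi p * qj q - qj p * qi q + qk p * qre q"

instance
  by standard (simp_all add: quat_eq_iff algebra_simps)

end

instantiation quat :: real_algebra_1
begin

primcorec scaleR_quat where
  "qre (scaleR c q) = c * qre q"
| "qi (scaleR c q) = c * qi q"
| "qj (scaleR c q) = c * qj q"
| "qk (scaleR c q) = c * qk q"

instance
  by standard (simp_all add: quat_eq_iff algebra_simps)

end

lemma of_real_quat_sel [simp]:
  "qre (of_real x) = x" "qi (of_real x) = 0" "qj (of_real x) = 0" "qk (of_real x) = 0"
  by (simp_all add: of_real_def)

instantiation quat :: real_div_algebra
begin

text \<open>The inverse is the conjugate divided by the squared modulus.\<close>

definition inverse_quat :: "quat \<Rightarrow> quat" where
  "inverse q = Quat (qre q) (- qi q) (- qj q) (- qk q)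
     /\<^sub>R ((qre q)\<^sup>2 + (qi q)\<^sup>2 + (qj q)\<^sup>2 + (qk q)\<^sup>2)"

definition divide_quat :: "quat \<Rightarrow> quat \<Rightarrow> quat" where
  "divide_quat p q = p * inverse q"

instance
proof
  fix p q :: quat
  assume "p \<noteq> 0"
  define n where "n = (qre p)\<^sup>2 + (qi p)\<^sup>2 + (qj p)\<^sup>2 + (qk p)\<^sup>2"
  have "n \<noteq> 0"
    using \<open>p \<noteq> 0\<close> unfolding n_def by (auto simp: quat_eq_iff add_nonneg_eq_0_iff)
  then have *: "inverse n * n = 1"
    by simp
  have conj: "inverse p = Quat (qre p) (- qi p) (- qj p) (- qk p) /\<^sub>R n"
    by (simp add: inverse_quat_def n_def)
  show "inverse p * p = 1"
    using * unfolding conj n_def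
    by (simp add: quat_eq_iff power2_eq_square algebra_simps)
  show "p * inverse p = 1"
    using * unfolding conj n_def
    by (simp add: quat_eq_iff power2_eq_square algebra_simps)
next
  fix p q :: quat
  show "p div q = p * inverse q"
    by (simp add: divide_quat_def)
  show "inverse (0::quat) = 0"
    by (simp add: inverse_quat_def quat_eq_iff)
qed

end

instantiation quat :: real_inner
begin

definition inner_quat :: "quat \<Rightarrow> quat \<Rightarrow> real" where
  "inner_quat p q = qre p * qre q + qi p * qi q + qj p * qj q + qk p * qk q"

definition norm_quat :: "quat \<Rightarrow> real" where
  "norm_quat q = sqrt ((qre q)\<^sup>2 + (qi q)\<^sup>2 + (qj q)\<^sup>2 + (qk q)\<^sup>2)"

definition sgn_quat :: "quat \<Rightarrow> quat" where
  "sgn_quat q = q /\<^sub>R norm q"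

definition dist_quat :: "quat \<Rightarrow> quat \<Rightarrow> real" where
  "dist_quat p q = norm (p - q)"

definition uniformity_quat :: "(quat \<times> quat) filter" where
  "uniformity_quat = (INF e\<in>{0 <..}. principal {(p, q). dist p q < e})"

definition open_quat :: "quat set \<Rightarrow> bool" where
  "open_quat U \<longleftrightarrow> (\<forall>p\<in>U. eventually (\<lambda>(p', q). p' = p \<longrightarrow> q \<in> U) uniformity)"

instance
proof
  fix p q s :: quat and c :: real
  show "inner p q = inner q p"
    by (simp add: inner_quat_def mult.commute)
  show "inner (p + q) s = inner p s + inner q s"
    by (simp add: inner_quat_def algebra_simps)
  show "inner (c *\<^sub>R p) q = c * inner p q"
    by (simp add: inner_quat_def algebra_simps)
  show "0 \<le> inner p p"
    by (simp add: inner_quat_def)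
  show "inner p p = 0 \<longleftrightarrow> p = 0"
    by (auto simp: inner_quat_def quat_eq_iff add_nonneg_eq_0_iff)
  show "norm p = sqrt (inner p p)"
    by (simp add: inner_quat_def norm_quat_def power2_eq_square)
qed (rule sgn_quat_def dist_quat_def uniformity_quat_def open_quat_def)+

end

instance quat :: real_normed_div_algebra
proof
  fix p q :: quat
  show "norm (p * q) = norm p * norm q"
    unfolding norm_quat_def real_sqrt_mult [symmetric]
    by (rule arg_cong [where f = sqrt]) (simp add: power2_eq_square algebra_simps)
qed

instantiation quat :: euclidean_space
begin

definition Basis_quat :: "quat set" where
  "Basis = {Quat 1 0 0 0, Quat 0 1 0 0, Quat 0 0 1 0, Quat 0 0 0 1}"

instance
proof
  fix u v p :: quat
  show "(Basis :: quat set) \<noteq> {}" and "finite (Basis :: quat set)"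
    by (simp_all add: Basis_quat_def)
  show "inner u v = (if u = v then 1 else 0)" if "u \<in> Basis" "v \<in> Basis"
    using that unfolding Basis_quat_def by (elim insertE emptyE) (simp_all add: inner_quat_def)
  show "(\<forall>u\<in>Basis. inner p u = 0) \<longleftrightarrow> p = 0"
    by (simp add: Basis_quat_def inner_quat_def quat_eq_iff [of p])
qed

end

section \<open>Slice regular functions\<close>

definition imag_units :: "quat set" where
  "imag_units = {q. q\<^sup>2 = - 1}"

definition slice_point :: "quat \<Rightarrow> real \<times> real \<Rightarrow> quat" where
  "slice_point I = (\<lambda>(x, y). of_real x + of_real y * I)"

text \<open>
  The set \<open>\<Omega>\<^sub>I\<close>, in the coordinates \<open>(x, y)\<close> of the plane \<open>L\<^sub>I = \<real> + I \<real>\<close>.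
\<close>
definition slice_coords :: "quat \<Rightarrow> quat set \<Rightarrow> (real \<times> real) set" where
  "slice_coords I \<Omega> = {p. slice_point I p \<in> \<Omega>}"

definition quat_domain :: "quat set \<Rightarrow> bool" where
  "quat_domain \<Omega> \<longleftrightarrow> open \<Omega> \<and> connected \<Omega> \<and> \<Omega> \<noteq> {}"

text \<open>
  Functions are total, so only the values on \<open>\<Omega>\<close> matter: for open \<open>\<Omega>\<close> the derivatives
  below depend only on the restriction of \<open>f\<close> to \<open>\<Omega>\<^sub>I\<close>.
  The witnesses \<open>fx\<close> and \<open>fy\<close> are the partial derivatives of
  \<open>(x, y) \<mapsto> f (x + y I)\<close>.
\<close>
definition slice_regular_on :: "quat set \<Rightarrow> (quat \<Rightarrow> quat) \<Rightarrow> bool" where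
  "slice_regular_on \<Omega> f \<longleftrightarrow>
     (\<forall>I\<in>imag_units. \<exists>fx fy :: real \<times> real \<Rightarrow> quat.
        continuous_on (slice_coords I \<Omega>) fx \<and>
        continuous_on (slice_coords I \<Omega>) fy \<and>
        (\<forall>(x, y)\<in>slice_coords I \<Omega>.
           ((\<lambda>t. f (slice_point I (t, y))) has_vector_derivative fx (x, y)) (at x) \<and>
           ((\<lambda>t. f (slice_point I (x, t))) has_vector_derivative fy (x, y)) (at y) \<and>
           (1 / 2) *\<^sub>R (fx (x, y) + I * fy (x, y)) = 0))"

end

theory Submission
  imports Defs "HOL-Complex_Analysis.Complex_Analysis"
begin

text \<open>
  Composing \<open>f\<close> on a slice \<open>L\<^sub>I\<close> with a real linear functional \<open>\<phi>\<close> yields a complex holomorphic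
  function \<open>\<phi> (f) - i \<phi> (I f)\<close>. Its Taylor coefficients at \<open>q\<^sub>0\<close> are determined by \<open>f\<close> on the real
  axis, so all slices share one expansion \<open>f q = \<Sum>n. (q - q\<^sub>0)\<^sup>n a\<^sub>n\<close>. In particular \<open>f\<close> is continuous
  on the closed ball and the maximum \<open>A\<close> is attained. Choosing the slice through \<open>a\<^sub>n\<close>, the classical
  coefficient estimate gives \<open>|a\<^sub>n| r\<^sup>n \<le> 2 A\<close> for \<open>n \<ge> 1\<close>, and a geometric series gives
  \<open>|f q| \<le> |\<beta>| + |\<gamma>| + 2 A \<rho> / (r - \<rho>)\<close>.
\<close>

section \<open>Slices as copies of the complex plane\<close>

text \<open>A complex argument in place of a pair makes the slice map a norm-preserving ring
  homomorphism for each imaginary unit, so quaternionic powers become complex powers and complex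
  analysis applies on the slice.\<close>

definition slice_embed :: "quat \<Rightarrow> complex \<Rightarrow> quat" where
  "slice_embed I z = of_real (Re z) + of_real (Im z) * I"

lemma slice_point_eq_slice_embed: "slice_point I (x, y) = slice_embed I (Complex x y)"
  by (simp add: slice_point_def slice_embed_def)

lemma slice_embed_of_real [simp]: "slice_embed I (of_real x) = of_real x"
  by (simp add: slice_embed_def)

lemma slice_embed_diff: "slice_embed I (z - w) = slice_embed I z - slice_embed I w"
  by (simp add: slice_embed_def algebra_simps)

text \<open>The imaginary coordinates of \<open>I * I\<close> are twice the real part times those of
  \<open>I\<close>, so a nonzero real part would force \<open>I\<close> to be real with square
  -1.\<close>

lemma imag_units_iff: "I \<in> imag_units \<longleftrightarrow> qre I = 0 \<and> (qi I)\<^sup>2 + (qj I)\<^sup>2 + (qk I)\<^sup>2 = 1"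
proof
  assume "I \<in> imag_units"
  then have *: "qre I * qre I - qi I * qi I - qj I * qj I - qk I * qk I = - 1"
    "qre I * qi I = 0" "qre I * qj I = 0" "qre I * qk I = 0"
    by (auto simp: imag_units_def power2_eq_square quat_eq_iff)
  have "qre I = 0"
  proof (rule ccontr)
    assume "qre I \<noteq> 0"
    with *(2-4) have "qi I = 0" "qj I = 0" "qk I = 0" by simp_all
    with *(1) have "qre I * qre I = - 1" by simp
    then show False by (metis zero_le_square not_one_le_zero neg_0_le_iff_le)
  qed
  with *(1) show "qre I = 0 \<and> (qi I)\<^sup>2 + (qj I)\<^sup>2 + (qk I)\<^sup>2 = 1"
    by (simp add: power2_eq_square)
next
  assume "qre I = 0 \<and> (qi I)\<^sup>2 + (qj I)\<^sup>2 + (qk I)\<^sup>2 = 1"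
  then show "I \<in> imag_units"
    by (simp add: imag_units_def power2_eq_square quat_eq_iff)
qed

lemma imag_unit_square: "I \<in> imag_units \<Longrightarrow> I * I = - 1"
  by (simp add: imag_units_def power2_eq_square)

lemma norm_imag_unit: "I \<in> imag_units \<Longrightarrow> norm I = 1"
  by (simp add: imag_units_iff norm_quat_def)

lemma norm_slice_embed: "I \<in> imag_units \<Longrightarrow> norm (slice_embed I z) = norm z"
proof -
  assume I: "I \<in> imag_units"
  have "(qi (slice_embed I z))\<^sup>2 + (qj (slice_embed I z))\<^sup>2 + (qk (slice_embed I z))\<^sup>2
      = (Im z)\<^sup>2 * ((qi I)\<^sup>2 + (qj I)\<^sup>2 + (qk I)\<^sup>2)"
    by (simp add: slice_embed_def power_mult_distrib distrib_left)
  then show ?thesis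
    using I by (simp add: imag_units_iff norm_quat_def cmod_def slice_embed_def add.assoc)
qed

lemma slice_embed_mult:
  "I \<in> imag_units \<Longrightarrow> slice_embed I (z * w) = slice_embed I z * slice_embed I w"
  using imag_unit_square [of I]
  by (simp add: slice_embed_def of_real_def algebra_simps)

lemma slice_embed_power:
  "I \<in> imag_units \<Longrightarrow> slice_embed I (z ^ n) = slice_embed I z ^ n"
  using slice_embed_of_real [of I 1]
  by (induction n) (simp_all add: slice_embed_mult)

text \<open>The unit is the normalised imaginary part; a real quaternion lies on every slice, so i
  serves.\<close>

lemma quat_slice_embedE:
  obtains I z where "I \<in> imag_units" "q = slice_embed I z"
proof -
  define m where "m = sqrt ((qi q)\<^sup>2 + (qj q)\<^sup>2 + (qk q)\<^sup>2)"
  have m2: "m\<^sup>2 = (qi q)\<^sup>2 + (qj q)\<^sup>2 + (qk q)\<^sup>2"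
    by (simp add: m_def)
  show ?thesis
  proof (cases "m = 0")
    case True
    then have "qi q = 0" "qj q = 0" "qk q = 0"
      using m2 by (auto simp: add_nonneg_eq_0_iff)
    then show ?thesis
      by (intro that [of "Quat 0 1 0 0" "of_real (qre q)"])
        (auto simp: imag_units_iff slice_embed_def quat_eq_iff)
  next
    case False
    have "(qi q / m)\<^sup>2 + (qj q / m)\<^sup>2 + (qk q / m)\<^sup>2 = m\<^sup>2 / m\<^sup>2"
      unfolding power_divide by (simp only: m2 add_divide_distrib)
    also have "\<dots> = 1"
      using False by simp
    finally show ?thesis
      using False
      by (intro that [of "Quat 0 (qi q / m) (qj q / m) (qk q / m)" "Complex (qre q) m"])
        (auto simp: imag_units_iff slice_embed_def quat_eq_iff)
  qed
qed

section \<open>From slice regularity to holomorphic components\<close>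

text \<open>Slice regularity supplies only partial derivatives, but complex differentiability needs
  a total one; continuity of the partials bridges the gap.\<close>

lemma slice_regular_has_derivative:
  assumes I: "I \<in> imag_units" and "open \<Omega>" and f: "slice_regular_on \<Omega> f"
    and p: "slice_point I (x, y) \<in> \<Omega>"
  obtains a b where "((\<lambda>p. f (slice_point I p)) has_derivative (\<lambda>(s, t). s *\<^sub>R a + t *\<^sub>R b)) (at (x, y))"
    and "a + I * b = 0"
proof -
  let ?S = "slice_coords I \<Omega>"
  obtain fx fy where "continuous_on ?S fx" and fyc: "continuous_on ?S fy"
    and D: "\<And>x y. (x, y) \<in> ?S \<Longrightarrow>
      ((\<lambda>t. f (slice_point I (t, y))) has_vector_derivative fx (x, y)) (at x) \<and>
      ((\<lambda>t. f (slice_point I (x, t))) has_vector_derivative fy (x, y)) (at y) \<and>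
      (1 / 2) *\<^sub>R (fx (x, y) + I * fy (x, y)) = 0"
    using f I unfolding slice_regular_on_def by fast
  have "open ?S"
  proof -
    have "continuous_on UNIV (slice_point I)"
      unfolding slice_point_def case_prod_unfold by (intro continuous_intros)
    then have "open (slice_point I -` \<Omega>)"
      using \<open>open \<Omega>\<close> by (rule open_vimage [rotated])
    then show ?thesis
      by (simp add: slice_coords_def vimage_def)
  qed
  moreover have pS: "(x, y) \<in> ?S"
    using p by (simp add: slice_coords_def)
  ultimately obtain X Y' where X: "open X" "open Y'" "(x, y) \<in> X \<times> Y'" "X \<times> Y' \<subseteq> ?S"
    by (rule open_prod_elim)
  \<comment> \<open>\<open>Y'\<close> is shrunk to a ball because the partial derivative criterion
    needs a convex second factor.\<close>
  then obtain e where e: "e > 0" "ball y e \<subseteq> Y'"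
    by (auto simp: open_contains_ball)
  define Y where "Y = ball y e"
  have XY: "X \<times> Y \<subseteq> ?S" "x \<in> X" "y \<in> Y" "open Y" "convex Y"
    using X e by (auto simp: Y_def)
  have "((\<lambda>(s, t). f (slice_point I (s, t))) has_derivative
      (\<lambda>(s, t). s *\<^sub>R fx (x, y) + blinfun_scaleR_left (fy (x, y)) t)) (at (x, y) within X \<times> Y)"
  proof (rule has_derivative_partialsI)
    show "((\<lambda>s. f (slice_point I (s, y))) has_derivative (\<lambda>s. s *\<^sub>R fx (x, y))) (at x within X)"
      using D [OF pS] by (auto simp: has_vector_derivative_def intro: has_derivative_at_withinI)
    show "((\<lambda>t. f (slice_point I (s, t))) has_derivative blinfun_scaleR_left (fy (s, t))) (at t within Y)"
      if "s \<in> X" "t \<in> Y" for s t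
    proof -
      have "(s, t) \<in> ?S" using that XY by auto
      from D [OF this] show ?thesis
        by (auto simp: has_vector_derivative_def intro: has_derivative_at_withinI)
    qed
    have "continuous (at (x, y) within X \<times> Y) fy"
      using fyc XY \<open>open ?S\<close> pS
      by (meson continuous_on_eq_continuous_within continuous_within_subset)
    then have "continuous (at (x, y) within X \<times> Y) (\<lambda>p. blinfun_scaleR_left (fy p))"
      by (rule bounded_linear.continuous [OF bounded_linear_blinfun_scaleR_left])
    then show "continuous (at (x, y) within X \<times> Y) (\<lambda>(s, t). blinfun_scaleR_left (fy (s, t)))"
      by (simp add: case_prod_unfold)
  qed (use XY in auto)
  moreover have "at (x, y) within X \<times> Y = at (x, y)"
    using XY X(1) by (intro at_within_open open_Times) auto
  ultimately have "((\<lambda>p. f (slice_point I p)) has_derivative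
      (\<lambda>(s, t). s *\<^sub>R fx (x, y) + t *\<^sub>R fy (x, y))) (at (x, y))"
    by (simp add: case_prod_unfold)
  moreover have "fx (x, y) + I * fy (x, y) = 0"
    using D [OF pS] by simp
  ultimately show ?thesis
    by (rule that)
qed

text \<open>Left multiplication by \<open>I\<close> makes the quaternions a complex vector space.
  The complex linear functional on it with real part \<open>\<phi>\<close> sends v to
  \<open>\<phi> v - \<i> * \<phi> (I * v)\<close>; this is that functional after
  \<open>f\<close>.\<close>

definition slice_component :: "(quat \<Rightarrow> quat) \<Rightarrow> quat \<Rightarrow> (quat \<Rightarrow> real) \<Rightarrow> complex \<Rightarrow> complex" where
  "slice_component f I \<phi> z = Complex (\<phi> (f (slice_embed I z))) (- \<phi> (I * f (slice_embed I z)))"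

lemma slice_component_holomorphic:
  assumes I: "I \<in> imag_units" and "open \<Omega>" and f: "slice_regular_on \<Omega> f"
    and \<phi>: "bounded_linear \<phi>"
  shows "slice_component f I \<phi> holomorphic_on {z. slice_embed I z \<in> \<Omega>}"
proof (rule holomorphic_onI, rule field_differentiable_at_within)
  interpret \<phi>: bounded_linear \<phi> by fact
  fix z assume "z \<in> {z. slice_embed I z \<in> \<Omega>}"
  then have "slice_point I (Re z, Im z) \<in> \<Omega>"
    by (simp add: slice_point_eq_slice_embed)
  from slice_regular_has_derivative [OF I \<open>open \<Omega>\<close> f this] obtain a b where
    D: "((\<lambda>p. f (slice_point I p)) has_derivative (\<lambda>(s, t). s *\<^sub>R a + t *\<^sub>R b)) (at (Re z, Im z))"
    and ab: "a + I * b = 0" .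
  then have Ib: "I * b = - a"
    by (simp add: eq_neg_iff_add_eq_0 add.commute)
  then have "I * (I * b) = - (I * a)"
    by simp
  then have Ia: "I * a = b"
    using imag_unit_square [OF I] by (simp flip: mult.assoc)
  have "((\<lambda>z. (Re z, Im z)) has_derivative (\<lambda>z. (Re z, Im z))) (at z)"
    by (auto intro!: derivative_eq_intros)
  from has_derivative_compose [OF this, of "\<lambda>p. f (slice_point I p)", OF D]
  have D': "((\<lambda>z. f (slice_embed I z)) has_derivative (\<lambda>w. Re w *\<^sub>R a + Im w *\<^sub>R b)) (at z)"
    by (simp add: slice_point_eq_slice_embed)
  have "((\<lambda>z. of_real (\<phi> (f (slice_embed I z))) - \<i> * of_real (\<phi> (I * f (slice_embed I z))))
     has_derivative (\<lambda>w. of_real (\<phi> (Re w *\<^sub>R a + Im w *\<^sub>R b))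
        - \<i> * of_real (\<phi> (I * (Re w *\<^sub>R a + Im w *\<^sub>R b))))) (at z)"
    by (intro derivative_intros D' \<phi>.has_derivative
        bounded_linear.has_derivative [OF bounded_linear_mult_right])
  \<comment> \<open>With \<open>b = I * a\<close>, the Cauchy-Riemann equation on the slice, the
    real derivative turns into multiplication by a single complex number.\<close>
  moreover have "(\<lambda>w. of_real (\<phi> (Re w *\<^sub>R a + Im w *\<^sub>R b))
        - \<i> * of_real (\<phi> (I * (Re w *\<^sub>R a + Im w *\<^sub>R b)))) = (*) (Complex (\<phi> a) (- \<phi> b))"
    by (simp add: fun_eq_iff complex_eq_iff distrib_left Ia Ib \<phi>.add \<phi>.scaleR \<phi>.diff mult.commute)
  moreover have "slice_component f I \<phi> =
      (\<lambda>z. of_real (\<phi> (f (slice_embed I z))) - \<i> * of_real (\<phi> (I * f (slice_embed I z))))"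
    by (auto simp: fun_eq_iff complex_eq_iff slice_component_def)
  ultimately show "slice_component f I \<phi> field_differentiable (at z)"
    unfolding field_differentiable_def has_field_derivative_def by auto
qed

section \<open>Complex coefficients bounded by the real part\<close>

text \<open>
  Adding to Cauchy's formula for the coefficient of index \<open>n\<close> the conjugate of the vanishing
  coefficient of index \<open>- n\<close> replaces \<open>h\<close> by \<open>2 Re h\<close> under the integral.
\<close>
lemma coefficient_bound_by_Re:
  fixes c :: complex and r R A :: real
  assumes h: "h holomorphic_on ball c R" and r: "0 < r" "r < R"
    and A: "\<And>z. norm (z - c) = r \<Longrightarrow> \<bar>Re (h z)\<bar> \<le> A" and n: "n > 0"
  shows "norm ((deriv ^^ n) h c / fact n) * r ^ n \<le> 2 * A"
proof -
  define b where "b = (deriv ^^ n) h c / fact n"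
  have sub: "cball c r \<subseteq> ball c R"
    using r by auto
  have "((\<lambda>u. h u / (u - c) ^ Suc n) has_contour_integral 2 * pi * \<i> / fact n * (deriv ^^ n) h c)
      (circlepath c r)"
    using h sub r
    by (intro Cauchy_has_contour_integral_higher_derivative_circlepath)
      (auto intro: holomorphic_on_imp_continuous_on holomorphic_on_subset)
  then have "((\<lambda>t. h (c + r * cis t) / (r * cis t) ^ Suc n * r * \<i> * cis t) has_integral
      2 * pi * \<i> * b) {0..2 * pi}"
    by (simp add: circlepath_def has_contour_integral_part_circlepath_iff b_def)
  \<comment> \<open>The factor cancels \<open>\<i>\<close> and all powers of \<open>r\<close> except
    the \<open>r ^ n\<close> kept beside \<open>b\<close>; what remains next to \<open>h\<close> is
    the conjugate of \<open>cis t ^ n\<close>.\<close>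
  from has_integral_mult_right [OF this, of "- \<i> * of_real r ^ n"]
  have "((\<lambda>t. - \<i> * of_real r ^ n * (h (c + r * cis t) / (r * cis t) ^ Suc n * r * \<i> * cis t))
      has_integral 2 * pi * (b * r ^ n)) {0..2 * pi}"
    by (simp add: mult_ac)
  moreover have "- \<i> * of_real r ^ n * (h (c + r * cis t) / (r * cis t) ^ Suc n * r * \<i> * cis t) =
      h (c + r * cis t) * cnj (cis t ^ n)" for t
  proof -
    have "cnj (cis t ^ n) = inverse (cis t ^ n)"
      by (simp add: cis_cnj power_inverse flip: cis_inverse)
    then show ?thesis
      using r by (simp add: power_mult_distrib field_simps)
  qed
  ultimately have 1: "((\<lambda>t. h (c + r * cis t) * cnj (cis t ^ n)) has_integral
      2 * pi * (b * r ^ n)) {0..2 * pi}"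
    by simp
  \<comment> \<open>Since \<open>n > 0\<close>, the exponent \<open>n - 1\<close> is a true
    predecessor; the integrand is holomorphic on the ball and Cauchy's theorem gives 0.\<close>
  have "((\<lambda>u. h u * (u - c) ^ (n - 1)) has_contour_integral 0) (circlepath c r)"
    using h r
    by (intro Cauchy_theorem_convex_simple [of _ "ball c R"] holomorphic_intros)
      (auto simp: path_image_circlepath)
  then have "((\<lambda>t. h (c + r * cis t) * (r * cis t) ^ (n - 1) * r * \<i> * cis t) has_integral 0)
      {0..2 * pi}"
    by (simp add: circlepath_def has_contour_integral_part_circlepath_iff)
  from has_integral_mult_right [OF this, of "- \<i> / of_real r ^ n"]
  have "((\<lambda>t. - \<i> / of_real r ^ n * (h (c + r * cis t) * (r * cis t) ^ (n - 1) * r * \<i> * cis t))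
      has_integral 0) {0..2 * pi}"
    by simp
  moreover have "- \<i> / of_real r ^ n * (h (c + r * cis t) * (r * cis t) ^ (n - 1) * r * \<i> * cis t) =
      h (c + r * cis t) * cis t ^ n" for t
    using r n by (cases n) (simp_all add: power_mult_distrib field_simps)
  ultimately have "((\<lambda>t. h (c + r * cis t) * cis t ^ n) has_integral 0) {0..2 * pi}"
    by simp
  \<comment> \<open>Conjugating gives both integrals the same factor \<open>cnj (cis t ^ n)\<close>,
    so that their sum contains only the real part of \<open>h\<close>.\<close>
  from has_integral_linear [OF this bounded_linear_cnj]
  have "((\<lambda>t. cnj (h (c + r * cis t)) * cnj (cis t ^ n)) has_integral 0) {0..2 * pi}"
    by (simp add: o_def)
  from has_integral_add [OF 1 this]
  have "((\<lambda>t. (h (c + r * cis t) + cnj (h (c + r * cis t))) * cnj (cis t ^ n)) has_integral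
      2 * pi * (b * r ^ n)) {0..2 * pi}"
    by (simp add: algebra_simps)
  moreover have "norm ((h (c + r * cis t) + cnj (h (c + r * cis t))) * cnj (cis t ^ n)) \<le> 2 * A" for t
  proof -
    have "\<bar>Re (h (c + r * cis t))\<bar> \<le> A"
      using r by (intro A) (simp add: norm_mult)
    then show ?thesis
      by (simp add: complex_add_cnj norm_mult norm_power)
  qed
  moreover have "0 \<le> A"
    using A [of "c + r"] r by auto
  ultimately have "norm (of_real (2 * pi) * (b * of_real r ^ n)) \<le> 2 * A * measure lborel {0..2 * pi}"
    by (intro has_integral_bound_real) auto
  then have "2 * pi * (norm b * r ^ n) \<le> 2 * pi * (2 * A)"
    using r by (simp add: norm_mult norm_power mult_ac)
  then show ?thesis
    by (simp add: b_def mult.commute)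
qed

section \<open>One power series for all slices\<close>

text \<open>The difference series sums to 0. At 0 it shows that the constant terms agree; if a later
  coefficient were nonzero, 0 would be an isolated zero of the zero function.\<close>

lemma powser_unique:
  fixes a b :: "nat \<Rightarrow> 'a::{real_normed_field,banach}"
  assumes "0 < R"
    and a: "\<And>x. norm x < R \<Longrightarrow> (\<lambda>n. a n * x ^ n) sums f x"
    and b: "\<And>x. norm x < R \<Longrightarrow> (\<lambda>n. b n * x ^ n) sums f x"
  shows "a = b"
proof (rule ccontr)
  assume "a \<noteq> b"
  then obtain m0 where "a m0 \<noteq> b m0" by auto
  have d: "(\<lambda>n. (a n - b n) * (x - 0) ^ n) sums 0" if "norm (x - 0) < R" for x
    using sums_diff [OF a b, of x x] that by (simp add: algebra_simps)
  have "a 0 = b 0"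
    using sums_unique2 [OF d [of 0]] \<open>0 < R\<close> powser_sums_zero [of "\<lambda>n. a n - b n"] by force
  with \<open>a m0 \<noteq> b m0\<close> have "m0 > 0" by (cases m0) auto
  obtain s where s: "0 < s" "\<And>z::'a. z \<in> cball 0 s - {0} \<Longrightarrow> (0::'a) \<noteq> 0"
    by (rule powser_0_nonzero [of R 0 "\<lambda>n. a n - b n" "\<lambda>_. 0" m0])
      (use \<open>0 < R\<close> d \<open>m0 > 0\<close> \<open>a m0 \<noteq> b m0\<close> in auto)
  have "of_real s \<in> cball (0::'a) s - {0}" using s(1) by simp
  from s(2) [OF this] show False by simp
qed

text \<open>Every slice contains the real axis. There the components of \<open>f\<close> have real
  power series, whose uniqueness ties the Taylor coefficients on each slice to one quaternion
  sequence. The first conclusion keeps this link for the coefficient estimate.\<close>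

lemma slice_regular_power_series:
  fixes c R :: real
  assumes f: "slice_regular_on \<Omega> f" and "open \<Omega>" and R: "0 < R" "ball (of_real c) R \<subseteq> \<Omega>"
  obtains a :: "nat \<Rightarrow> quat" where
    "\<And>I \<phi> n. I \<in> imag_units \<Longrightarrow> bounded_linear \<phi> \<Longrightarrow>
      (deriv ^^ n) (slice_component f I \<phi>) (of_real c) / fact n = Complex (\<phi> (a n)) (- \<phi> (I * a n))"
    "\<And>q. q \<in> ball (of_real c) R \<Longrightarrow> (\<lambda>n. (q - of_real c) ^ n * a n) sums f q"
proof -
  define b where "b = (\<lambda>I \<phi> n. (deriv ^^ n) (slice_component f I \<phi>) (of_real c) / fact n)"
  have in_ball: "slice_embed I z \<in> ball (of_real c) R" if "I \<in> imag_units" "norm (z - of_real c) < R" for I z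
    using that norm_slice_embed [of I "z - of_real c"]
    by (simp add: slice_embed_diff dist_norm norm_minus_commute)
  have S: "(\<lambda>n. b I \<phi> n * w ^ n) sums slice_component f I \<phi> (of_real c + w)"
    if I: "I \<in> imag_units" and \<phi>: "bounded_linear \<phi>" and w: "norm w < R" for I \<phi> w
  proof -
    have "slice_component f I \<phi> holomorphic_on ball (of_real c) R"
      using in_ball [OF I] R(2)
      by (intro holomorphic_on_subset [OF slice_component_holomorphic [OF I \<open>open \<Omega>\<close> f \<phi>]])
        (auto simp: dist_norm norm_minus_commute)
    from holomorphic_power_series [OF this, of "of_real c + w"] w show ?thesis
      by (simp add: b_def dist_norm)
  qed

  define I0 where "I0 = Quat 0 1 0 0"
  have I0: "I0 \<in> imag_units"
    by (simp add: I0_def imag_units_iff)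
  \<comment> \<open>The coefficients are assembled by coordinates on the reference slice of i; they
    do not depend on this choice, as the next steps show.\<close>
  define a where "a = (\<lambda>n. \<Sum>e\<in>Basis. Re (b I0 (\<lambda>q. inner q e) n) *\<^sub>R (e::quat))"
  have real_sums: "(\<lambda>n. t ^ n *\<^sub>R a n) sums f (of_real (c + t))" if t: "norm t < R" for t :: real
  proof -
    have "(\<lambda>n. Re (b I0 (\<lambda>q. inner q e) n) * t ^ n) sums inner (f (of_real (c + t))) e" for e
      using sums_Re [OF S [OF I0 bounded_linear_inner_left, of "of_real t" e]] t
      by (simp add: slice_component_def Re_power_real flip: of_real_add of_real_power)
    then have "(\<lambda>n. \<Sum>e\<in>Basis. (Re (b I0 (\<lambda>q. inner q e) n) * t ^ n) *\<^sub>R e)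
        sums (\<Sum>e\<in>Basis. inner (f (of_real (c + t))) e *\<^sub>R e)"
      by (intro sums_sum sums_scaleR_left)
    then show ?thesis
      by (simp add: a_def euclidean_representation scaleR_sum_right mult.commute)
  qed
  have b: "b I \<phi> n = Complex (\<phi> (a n)) (- \<phi> (I * a n))"
    if I: "I \<in> imag_units" and \<phi>: "bounded_linear \<phi>" for I \<phi> n
  proof -
    have \<psi>: "bounded_linear (\<lambda>q. - \<phi> (I * q))"
      by (intro bounded_linear_minus bounded_linear_compose [OF \<phi>] bounded_linear_mult_right)
    have *: "(\<lambda>n. \<phi>' (a n) * t ^ n) sums \<phi>' (f (of_real (c + t)))"
      if "bounded_linear \<phi>'" "norm t < R" for \<phi>' and t :: real
      using bounded_linear.sums [OF that(1) real_sums [OF that(2)]]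
      by (simp add: linear_scale [OF bounded_linear.linear [OF that(1)]] mult.commute)
    \<comment> \<open>For real \<open>t\<close> the component is evaluated at a real quaternion, so
      its real and imaginary parts are functionals of values of \<open>f\<close> on the real axis.
      Both also expand with coefficients obtained from \<open>a n\<close>.\<close>
    have re: "(\<lambda>n. Re (b I \<phi> n) * t ^ n) sums \<phi> (f (of_real (c + t)))"
      and im: "(\<lambda>n. Im (b I \<phi> n) * t ^ n) sums - \<phi> (I * f (of_real (c + t)))" if "norm t < R" for t :: real
      using sums_Re [OF S [OF I \<phi>, of "of_real t"]] sums_Im [OF S [OF I \<phi>, of "of_real t"]] that
      by (simp_all add: slice_component_def flip: of_real_add of_real_power)
    have "(\<lambda>n. Re (b I \<phi> n)) = (\<lambda>n. \<phi> (a n))"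
      by (rule powser_unique [OF R(1) re * [OF \<phi>]])
    moreover have "(\<lambda>n. Im (b I \<phi> n)) = (\<lambda>n. - \<phi> (I * a n))"
      by (rule powser_unique [OF R(1) im * [OF \<psi>]])
    ultimately show ?thesis
      by (simp add: complex_eq_iff fun_eq_iff)
  qed
  have "(\<lambda>n. (q - of_real c) ^ n * a n) sums f q" if q: "q \<in> ball (of_real c) R" for q
  proof -
    obtain I z where I: "I \<in> imag_units" and z: "q = slice_embed I z"
      by (rule quat_slice_embedE)
    define w where "w = z - of_real c"
    have qc: "q - of_real c = slice_embed I w"
      by (simp add: w_def z slice_embed_diff)
    have w: "norm w < R"
      using q norm_slice_embed [OF I, of w] by (simp add: dist_norm norm_minus_commute flip: qc)
    have "(\<lambda>n. inner ((q - of_real c) ^ n * a n) e) sums inner (f q) e" for e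
    proof -
      \<comment> \<open>With \<open>w ^ n\<close> = u + iv, the real part of \<open>b\<close> times
        \<open>w ^ n\<close> is \<open>\<phi> (a n)\<close> u + \<open>\<phi> (I * a n)\<close> v,
        the functional of (u + vI) times \<open>a n\<close>.\<close>
      have "Re (b I (\<lambda>q. inner q e) n * w ^ n) = inner ((q - of_real c) ^ n * a n) e" for n
        unfolding b [OF I bounded_linear_inner_left] qc slice_embed_power [OF I, symmetric]
        by (simp add: slice_embed_def of_real_def inner_add_left algebra_simps)
      with sums_Re [OF S [OF I bounded_linear_inner_left w, of e]] show ?thesis
        by (simp add: slice_component_def w_def z)
    qed
    then have "(\<lambda>n. \<Sum>e\<in>Basis. inner ((q - of_real c) ^ n * a n) e *\<^sub>R e)
        sums (\<Sum>e\<in>Basis. inner (f q) e *\<^sub>R e)"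
      by (intro sums_sum sums_scaleR_left)
    then show ?thesis
      by (simp add: euclidean_representation)
  qed
  with b show ?thesis
    unfolding b_def by (rule that)
qed

text \<open>Convergence at the real point \<open>c + s\<close> with \<open>r < s < R\<close> gives
  absolute convergence at radius \<open>r\<close>, hence a Weierstrass majorant on the closed ball.
  A real offset commutes with the coefficients, so they may be moved to the left.\<close>

lemma continuous_on_quat_power_series:
  fixes a :: "nat \<Rightarrow> quat" and c r R :: real
  assumes f: "\<And>q. q \<in> ball (of_real c) R \<Longrightarrow> (\<lambda>n. (q - of_real c) ^ n * a n) sums f q"
    and r: "0 < r" "r < R"
  shows "continuous_on (cball (of_real c) r) f"
proof -
  define s where "s = (r + R) / 2"
  have s: "r < s" "s < R"
    using r by (auto simp: s_def)
  have "(\<lambda>n. of_real s ^ n * a n) sums f (of_real (c + s))"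
    using f [of "of_real (c + s)"] s r by (simp add: dist_norm)
  moreover have "of_real s ^ n * a n = a n * of_real s ^ n" for n
    by (simp add: of_real_def flip: of_real_power)
  ultimately have "summable (\<lambda>n. a n * of_real s ^ n)"
    by (simp add: sums_iff)
  then have M: "summable (\<lambda>n. norm (a n * of_real r ^ n))"
    by (rule powser_insidea) (use s r in simp)
  have "uniform_limit (cball (of_real c) r) (\<lambda>N q. \<Sum>n<N. (q - of_real c) ^ n * a n)
      (\<lambda>q. \<Sum>n. (q - of_real c) ^ n * a n) sequentially"
  proof (rule Weierstrass_m_test [OF _ M])
    fix n and q :: quat assume "q \<in> cball (of_real c) r"
    then have "norm (q - of_real c) ^ n \<le> r ^ n"
      by (intro power_mono) (auto simp: dist_norm norm_minus_commute)
    then show "norm ((q - of_real c) ^ n * a n) \<le> norm (a n * of_real r ^ n)"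
      using r by (simp add: norm_mult norm_power mult_right_mono mult.commute [of "norm (a n)"])
  qed
  then have "continuous_on (cball (of_real c) r) (\<lambda>q. \<Sum>n. (q - of_real c) ^ n * a n)"
    by (rule uniform_limit_theorem [rotated]) (auto intro!: continuous_intros always_eventually)
  then show ?thesis
    by (rule continuous_on_eq) (use f r in \<open>auto simp: sums_iff\<close>)
qed

section \<open>Bound for the quaternionic coefficients\<close>

lemma bounded_linear_qre: "bounded_linear qre"
  using bounded_linear_inner_left [of "1 :: quat"] by (simp add: inner_quat_def)

text \<open>
  The coefficient \<open>a n\<close> lies in some plane \<open>L\<^sub>I\<close>; on the corresponding slice the real part of
  \<open>f\<close> is the real part of a holomorphic function whose \<open>n\<close>-th coefficient is \<open>a n\<close> itself.
\<close>
lemma slice_regular_coefficient_bound: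
  fixes c r R A :: real
  assumes f: "slice_regular_on \<Omega> f" and "open \<Omega>" and R: "ball (of_real c) R \<subseteq> \<Omega>"
    and a: "\<And>I. I \<in> imag_units \<Longrightarrow>
      (deriv ^^ n) (slice_component f I qre) (of_real c) / fact n = Complex (qre a) (- qre (I * a))"
    and r: "0 < r" "r < R"
    and A: "\<And>q. norm (q - of_real c) = r \<Longrightarrow> \<bar>qre (f q)\<bar> \<le> A" and "n > 0"
  shows "norm a * r ^ n \<le> 2 * A"
proof -
  obtain I z where I: "I \<in> imag_units" and z: "a = slice_embed I z"
    by (rule quat_slice_embedE)
  have norm_diff: "norm (slice_embed I u - of_real c) = norm (u - of_real c)" for u
    using norm_slice_embed [OF I, of "u - of_real c"] by (simp add: slice_embed_diff)
  have "slice_component f I qre holomorphic_on ball (of_real c) R"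
    using R norm_diff
    by (intro holomorphic_on_subset
        [OF slice_component_holomorphic [OF I \<open>open \<Omega>\<close> f bounded_linear_qre]])
      (auto simp: subset_iff dist_norm norm_minus_commute)
  then have "norm ((deriv ^^ n) (slice_component f I qre) (of_real c) / fact n) * r ^ n \<le> 2 * A"
    using r _ \<open>n > 0\<close>
    by (rule coefficient_bound_by_Re) (simp add: slice_component_def A norm_diff)
  \<comment> \<open>Because \<open>a\<close> lies in the chosen slice, \<open>I * a\<close> has real
    part \<open>- Im z\<close>, so the complex Taylor coefficient is \<open>z\<close> and has the
    norm of \<open>a\<close>.\<close>
  moreover have "Complex (qre a) (- qre (I * a)) = z"
  proof -
    have "I * a = of_real (Re z) * I - of_real (Im z)"
      using imag_unit_square [OF I] by (simp add: z slice_embed_def of_real_def algebra_simps)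
    then show ?thesis
      using I by (simp add: z slice_embed_def imag_units_iff)
  qed
  ultimately show ?thesis
    using norm_slice_embed [OF I, of z] by (simp add: a [OF I] z)
qed

section \<open>Attained maxima and a larger ball\<close>

text \<open>\<open>GREATEST\<close> is informative only if a greatest element exists; compactness
  and continuity provide one.\<close>

lemma le_Greatest_image:
  fixes g :: "'a::topological_space \<Rightarrow> real"
  assumes "compact K" "continuous_on K g" "x \<in> K"
  shows "g x \<le> (GREATEST y. y \<in> g ` K)"
proof -
  obtain m where "m \<in> K" "\<And>x. x \<in> K \<Longrightarrow> g x \<le> g m"
    using continuous_attains_sup [OF assms(1) _ assms(2)] assms(3) by blast
  then have "(GREATEST y. y \<in> g ` K) = g m"
    by (intro Greatest_equality) auto
  with \<open>\<And>x. x \<in> K \<Longrightarrow> g x \<le> g m\<close> assms(3) show ?thesis by simp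
qed

text \<open>Compactness gives one \<open>e\<close> for which all balls of radius \<open>e\<close>
  around points of the closed ball stay in \<open>S\<close>. A point outside the closed ball is
  reached from its radial projection \<open>p\<close> onto the sphere, at distance
  \<open>d - r < e\<close>.\<close>

lemma cball_subset_open_imp_larger_ball:
  fixes c :: "'a::euclidean_space"
  assumes "r > 0" "open S" "cball c r \<subseteq> S"
  obtains R where "r < R" "ball c R \<subseteq> S"
proof -
  obtain e where e: "e > 0" "(\<Union>x\<in>cball c r. ball x e) \<subseteq> S"
    using compact_subset_open_imp_ball_epsilon_subset [OF compact_cball assms(2,3)] by blast
  have "ball c (r + e) \<subseteq> S"
  proof
    fix q assume q: "q \<in> ball c (r + e)"
    show "q \<in> S"
    proof (cases "norm (q - c) \<le> r")
      case True
      then show ?thesis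
        using assms(3) by (auto simp: dist_norm norm_minus_commute)
    next
      case False
      define d where "d = norm (q - c)"
      have d: "r < d" "d < r + e"
        using False q by (auto simp: d_def dist_norm norm_minus_commute)
      define p where "p = c + (r / d) *\<^sub>R (q - c)"
      have "norm (p - c) = r"
        using d \<open>r > 0\<close> by (simp add: p_def flip: d_def)
      moreover have "norm (q - p) = d - r"
      proof -
        have "q - p = (1 - r / d) *\<^sub>R (q - c)"
          by (simp add: p_def algebra_simps)
        then have "norm (q - p) = (1 - r / d) * d"
          using d \<open>r > 0\<close> by (simp flip: d_def)
        then show ?thesis
          using d \<open>r > 0\<close> by (simp add: left_diff_distrib)
      qed
      ultimately have "p \<in> cball c r" "q \<in> ball p e"
        using d by (auto simp: dist_norm norm_minus_commute)
      with e(2) show ?thesis by blast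
    qed
  qed
  then show ?thesis
    using \<open>e > 0\<close> by (intro that [of "r + e"]) auto
qed

section \<open>The geometric series estimate\<close>

theorem theorem3p1:
  fixes q\<^sub>0 r \<rho> A \<beta> \<gamma> :: real and f :: "quat \<Rightarrow> quat" and \<Omega> :: "quat set" and I :: quat
  assumes "r > 0"
    and "quat_domain \<Omega>" and "cball (of_real q\<^sub>0) r \<subseteq> \<Omega>" and "slice_regular_on \<Omega> f"
    and "A = (GREATEST a. a \<in> (\<lambda>q. \<bar>qre (f q)\<bar>) ` sphere (of_real q\<^sub>0) r)"
    and "I \<in> imag_units" and "f (of_real q\<^sub>0) = of_real \<beta> + of_real \<gamma> * I"
    and "0 < \<rho>" and "\<rho> < r"
  shows "\<forall>q \<in> ball (of_real q\<^sub>0) r. norm (q - of_real q\<^sub>0) \<le> \<rho> \<longrightarrow>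
           norm (f q) \<le> \<bar>\<gamma>\<bar> + \<bar>\<beta>\<bar> * ((r + \<rho>) / (r - \<rho>)) + 2 * A * (\<rho> / (r - \<rho>))"
proof (intro ballI impI)
  have "open \<Omega>"
    using \<open>quat_domain \<Omega>\<close> by (simp add: quat_domain_def)
  then obtain R where R: "r < R" "ball (of_real q\<^sub>0) R \<subseteq> \<Omega>"
    using cball_subset_open_imp_larger_ball [OF \<open>r > 0\<close> _ assms(3)] by blast
  then have "0 < R" and ball: "ball (of_real q\<^sub>0) R \<subseteq> \<Omega>"
    using \<open>r > 0\<close> by auto
  obtain a where coeff: "\<And>I \<phi> n. I \<in> imag_units \<Longrightarrow> bounded_linear \<phi> \<Longrightarrow>
      (deriv ^^ n) (slice_component f I \<phi>) (of_real q\<^sub>0) / fact n = Complex (\<phi> (a n)) (- \<phi> (I * a n))"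
    and a: "\<And>q::quat. q \<in> ball (of_real q\<^sub>0) R \<Longrightarrow> (\<lambda>n. (q - of_real q\<^sub>0) ^ n * a n) sums f q"
    using slice_regular_power_series [OF assms(4) \<open>open \<Omega>\<close> \<open>0 < R\<close> ball] by blast
  have "continuous_on (sphere (of_real q\<^sub>0) r) (\<lambda>q. \<bar>qre (f q)\<bar>)"
    using continuous_on_quat_power_series [OF a \<open>r > 0\<close> \<open>r < R\<close>]
    by (intro continuous_on_rabs bounded_linear.continuous_on [OF bounded_linear_qre])
      (auto intro: continuous_on_subset)
  then have A: "\<bar>qre (f q)\<bar> \<le> A" if "norm (q - of_real q\<^sub>0) = r" for q
    unfolding assms(5) using that
    by (intro le_Greatest_image) (auto simp: dist_norm norm_minus_commute)
  have coeff_bound: "norm (a n) * r ^ n \<le> 2 * A" if "n > 0" for n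
    using slice_regular_coefficient_bound
      [OF assms(4) \<open>open \<Omega>\<close> ball coeff [OF _ bounded_linear_qre] \<open>r > 0\<close> \<open>r < R\<close> A that] .

  fix q :: quat assume "q \<in> ball (of_real q\<^sub>0) r" and q: "norm (q - of_real q\<^sub>0) \<le> \<rho>"
  define x where "x = \<rho> / r"
  have x: "0 < x" "x < 1"
    using assms(1,8,9) by (auto simp: x_def)
  have "f (of_real q\<^sub>0) = a 0"
  proof -
    have "(\<lambda>n. 0 ^ n * a n) sums f (of_real q\<^sub>0)"
      using a [of "of_real q\<^sub>0"] \<open>0 < R\<close> by simp
    moreover have "(\<lambda>n. 0 ^ n * a n) sums (0 ^ 0 * a 0)"
      using sums_finite [of "{0}" "\<lambda>n. 0 ^ n * a n"] by (simp add: power_0_left)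
    ultimately show ?thesis
      by (simp add: sums_unique2)
  qed
  have "(\<lambda>n. (q - of_real q\<^sub>0) ^ n * a n) sums f q"
    using q assms(9) \<open>r < R\<close> by (intro a) (simp add: dist_norm norm_minus_commute)
  \<comment> \<open>The constant term is split off because the coefficient bound holds only for
    positive indices.\<close>
  then have "(\<lambda>n. (q - of_real q\<^sub>0) ^ Suc n * a (Suc n)) sums (f q - a 0)"
    by (subst sums_Suc_iff) simp
  moreover have "(\<lambda>n. 2 * A * (x * x ^ n)) sums (2 * A * (x * (1 / (1 - x))))"
    using x by (intro sums_mult geometric_sums) simp
  moreover have "norm ((q - of_real q\<^sub>0) ^ Suc n * a (Suc n)) \<le> 2 * A * (x * x ^ n)" for n
  proof -
    have "norm ((q - of_real q\<^sub>0) ^ Suc n * a (Suc n)) \<le> \<rho> ^ Suc n * norm (a (Suc n))"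
      unfolding norm_mult norm_power by (intro mult_right_mono power_mono q) auto
    \<comment> \<open>Writing \<open>\<rho>\<close> as \<open>x * r\<close> supplies the power of
      \<open>r\<close> that the coefficient bound needs and leaves a geometric series of ratio
      \<open>x\<close>.\<close>
    also have "\<dots> = x ^ Suc n * (norm (a (Suc n)) * r ^ Suc n)"
      using assms(1) by (simp add: x_def power_divide)
    also have "\<dots> \<le> x ^ Suc n * (2 * A)"
      using x by (intro mult_left_mono coeff_bound) auto
    finally show ?thesis by (simp add: mult_ac)
  qed
  ultimately have "norm (f q - a 0) \<le> 2 * A * (x * (1 / (1 - x)))"
    by (rule norm_sums_le)
  also have "x * (1 / (1 - x)) = \<rho> / (r - \<rho>)"
    using assms(1,9) by (simp add: x_def field_simps)
  finally have "norm (f q - a 0) \<le> 2 * A * (\<rho> / (r - \<rho>))" .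
  moreover have "norm (a 0) \<le> \<bar>\<beta>\<bar> + \<bar>\<gamma>\<bar>"
    using norm_triangle_ineq [of "of_real \<beta>" "of_real \<gamma> * I"] norm_imag_unit [OF assms(6)]
    by (simp add: norm_mult assms(7) flip: \<open>f (of_real q\<^sub>0) = a 0\<close>)
  \<comment> \<open>The factor is at least 1, so the bound with the plain absolute value of
    \<open>\<beta>\<close> implies the stated one.\<close>
  moreover have "\<bar>\<beta>\<bar> * 1 \<le> \<bar>\<beta>\<bar> * ((r + \<rho>) / (r - \<rho>))"
    using assms(8,9) by (intro mult_left_mono) auto
  moreover have "norm (f q) \<le> norm (f q - a 0) + norm (a 0)"
    using norm_triangle_ineq [of "f q - a 0" "a 0"] by simp
  ultimately show "norm (f q) \<le> \<bar>\<gamma>\<bar> + \<bar>\<beta>\<bar> * ((r + \<rho>) / (r - \<rho>)) + 2 * A * (\<rho> / (r - \<rho>))"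
    by simp
qed

end
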